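(* If $\{a_i\}_{i=1}^{\infty}$ is a decreasing sequence of positive real numbers with $\sum_{i=1}^\infty a_i=\infty$, then $$\lambda_2\Big(\bigcap_{n=1}^{\infty}\bigcup_{i=n}^{\infty} T^{-i}B((y,0),a_i)\Big)\ge 1\qquad\text{for every } y\in[0,1).$$
   Context: Fix an irrational badly approximable $\alpha\in(0,1/3)$ (that is, $\liminf_{n\to\infty} n\,d(n\alpha,\mathbb{Z})>0$). Expressions involving $\alpha$ are interpreted mod 1; in particular $m\alpha$ denotes the representative in $[0,1)$. Let $q_i$ be the denominator of the $i$-th continued fraction convergent of $\alpha$ (indexed with $q_0=1$, so that for even indices $q_{2i}\alpha$ mod 1 equals $d(q_{2i}\alpha,\mathbb{Z})$). Put $c_i=q_{10^i}$ and $b_i=q_{2\cdot 10^i}$ for $i\ge1$. Let $J=[0,\sum_{i=1}^\infty c_i\alpha)$, $y_\infty=\alpha+\sum_{i=1}^\infty b_i\alpha$, and $J'=y_\infty+J$. Define $T:[0,1)\times\mathbb{Z}_2\to[0,1)\times\mathbb{Z}_2$ by $T(x,i)=(x+\alpha,\ i+\chi_{J\cup J'}(x))$. $\lambda_2$ is Lebesgue measure on $[0,1)\times\mathbb{Z}_2$ (total mass $2$). For $j\in\mathbb{Z}_2$ and $r>0$, $B((y,j),r)=\{(x,j): d(x-y,\mathbb{Z})<r\}$. *)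

theory Defs
  imports "HOL-Analysis.Analysis" "HOL-Library.Z2"
begin

definition dist_int :: "real \<Rightarrow> real" where
  "dist_int x = infdist x \<int>"

definition badly_approximable :: "real \<Rightarrow> bool" where
  "badly_approximable \<alpha> \<longleftrightarrow> liminf (\<lambda>n. ereal (real n * dist_int (real n * \<alpha>))) > 0"

fun complete_quotient :: "real \<Rightarrow> nat \<Rightarrow> real" where
  "complete_quotient \<alpha> 0 = \<alpha>"
| "complete_quotient \<alpha> (Suc n) = 1 / frac (complete_quotient \<alpha> n)"

definition partial_quotient :: "real \<Rightarrow> nat \<Rightarrow> int" where
  "partial_quotient \<alpha> n = \<lfloor>complete_quotient \<alpha> n\<rfloor>"

fun cf_value :: "int list \<Rightarrow> rat" where
  "cf_value [] = 0"
| "cf_value [a] = of_int a"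
| "cf_value (a # b # bs) = of_int a + 1 / cf_value (b # bs)"

definition convergent_of :: "real \<Rightarrow> nat \<Rightarrow> rat" where
  "convergent_of \<alpha> n = cf_value (map (partial_quotient \<alpha>) [0..<Suc n])"

(* quotient_of returns the fraction in lowest terms with positive denominator;
   the 0th convergent is the integer part of \<alpha>, so the 0th denominator is 1. *)
definition conv_denom :: "real \<Rightarrow> nat \<Rightarrow> int" where
  "conv_denom \<alpha> n = snd (quotient_of (convergent_of \<alpha> n))"

definition c_seq :: "real \<Rightarrow> nat \<Rightarrow> int" where
  "c_seq \<alpha> i = conv_denom \<alpha> (10 ^ i)"

definition b_seq :: "real \<Rightarrow> nat \<Rightarrow> int" where
  "b_seq \<alpha> i = conv_denom \<alpha> (2 * 10 ^ i)"

(* The multiples of \<alpha> are reduced to [0,1) before summing; the sums, over i \<ge> 1, are taken in the reals.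
   For irrational \<alpha> in (0,1/3) both series converge: the even-indexed denominators give
   frac (conv_denom \<alpha> (2 * k) * \<alpha>) < 1 / conv_denom \<alpha> (2 * k + 1).
   They are so small that y_inf \<alpha> and the right end point of J_set \<alpha> lie in (0,1). *)
definition J_set :: "real \<Rightarrow> real set" where
  "J_set \<alpha> = {0..<(\<Sum>i. frac (real_of_int (c_seq \<alpha> (Suc i)) * \<alpha>))}"

definition y_inf :: "real \<Rightarrow> real" where
  "y_inf \<alpha> = \<alpha> + (\<Sum>i. frac (real_of_int (b_seq \<alpha> (Suc i)) * \<alpha>))"

definition J'_set :: "real \<Rightarrow> real set" where
  "J'_set \<alpha> = (\<lambda>x. frac (y_inf \<alpha> + x)) ` J_set \<alpha>"

definition skew_T :: "real \<Rightarrow> real \<times> bit \<Rightarrow> real \<times> bit" where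
  "skew_T \<alpha> = (\<lambda>(x, i). (frac (x + \<alpha>), i + indicator (J_set \<alpha> \<union> J'_set \<alpha>) x))"

definition lambda2 :: "(real \<times> bit) measure" where
  "lambda2 = lebesgue_on {0..<1} \<Otimes>\<^sub>M count_space UNIV"

definition Ball2 :: "real \<times> bit \<Rightarrow> real \<Rightarrow> (real \<times> bit) set" where
  "Ball2 = (\<lambda>(y, j) r. {(x, j) | x. x \<in> {0..<1} \<and> dist_int (x - y) < r})"

(* skew_T is a total function on real \<times> bit, so preimages are cut down to the
   phase space [0,1) \<times> Z/2, which it maps into itself. *)
definition preimage_T :: "real \<Rightarrow> nat \<Rightarrow> (real \<times> bit) set \<Rightarrow> (real \<times> bit) set" where
  "preimage_T \<alpha> n A = (skew_T \<alpha> ^^ n) -` A \<inter> ({0..<1} \<times> UNIV)"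

end

theory Submission
  imports Defs
begin

text \<open>The fibre coordinate costs nothing: \<open>T\<^sup>i\<close> adds the same element of \<open>\<int>/2\<close> to both points over
  \<open>x\<close>, so whenever \<open>x + i \<alpha>\<close> is within \<open>a\<^sub>i\<close> of \<open>y\<close>, exactly one of \<open>(x,0)\<close>, \<open>(x,1)\<close> hits the
  target at time \<open>i\<close>. If this occurs for infinitely many \<open>i\<close>, one of the two points hits infinitely
  often. The bound therefore follows from Kurzweil's theorem that almost every \<open>x\<close> has this property
  for the rotation, whatever measurable set defines the cocycle.

  For Kurzweil's theorem, the points \<open>p\<^sub>i = y - i \<alpha>\<close> with \<open>N \<le> i < 2N\<close> are separated and dense at
  scale \<open>1/N\<close>. Suppose a set of measure \<open>g > 0\<close> avoids the intervals around all late \<open>p\<^sub>i\<close>, and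
  remove these intervals block by block with \<open>N = Q\<^sup>n\<close>. For \<open>Q\<close> large compared to \<open>1/g\<close> the
  remaining set has few boundary points at scale \<open>1/N\<close>, so a proportion of about \<open>g\<close> of the next
  block lies well inside it, and the measure drops by a constant times \<open>Q\<^sup>n\<close> times the new radius.
  By Cauchy condensation these drops sum to infinity.\<close>

section \<open>Separation and density of rotation orbits\<close>

lemma dist_int_le: "dist_int x \<le> \<bar>x - of_int k\<bar>"
  using infdist_le[of "of_int k" \<int> x] by (simp add: dist_int_def dist_real_def)

lemma dist_int_pos: "x \<notin> \<int> \<Longrightarrow> dist_int x > 0"
  unfolding dist_int_def by (intro infdist_pos_not_in_closed closed_Ints) auto

text \<open>The liminf bounds all late terms from below; irrationality makes the finitely many
  others positive, so a finite minimum yields one constant for all \<open>n\<close>.\<close>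

lemma badly_approximable_lower_bound:
  assumes "\<alpha> \<notin> \<rat>" and "badly_approximable \<alpha>"
  obtains c where "c > 0" and "\<And>n. n \<ge> 1 \<Longrightarrow> c \<le> real n * dist_int (real n * \<alpha>)"
proof -
  let ?f = "\<lambda>n. real n * dist_int (real n * \<alpha>)"
  have pos: "?f n > 0" if "n \<ge> 1" for n
  proof -
    have "real n * \<alpha> \<notin> \<int>"
    proof
      assume "real n * \<alpha> \<in> \<int>"
      then have "real n * \<alpha> / real n \<in> \<rat>"
        by (intro Rats_divide) (auto intro: Ints_subset_Rats[THEN subsetD])
      with that assms(1) show False by simp
    qed
    then show ?thesis using that dist_int_pos by simp
  qed
  obtain e where e: "0 < ereal e" "ereal e < liminf (\<lambda>n. ereal (?f n))"
    using assms(2) ereal_dense2 unfolding badly_approximable_def by blast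
  from less_LiminfD[OF e(2)] obtain M where M: "\<And>n. n \<ge> M \<Longrightarrow> e < ?f n"
    by (auto simp: eventually_sequentially)
  define c where "c = Min (insert e (?f ` {1..M}))"
  have "c > 0"
    unfolding c_def using e(1) pos by (subst Min_gr_iff) auto
  moreover have "c \<le> ?f n" if "n \<ge> 1" for n
  proof (cases "n \<le> M")
    case True
    then show ?thesis unfolding c_def using that by (intro Min_le) auto
  next
    case False
    have "c \<le> e" unfolding c_def by (intro Min_le) auto
    with M[of n] False show ?thesis by simp
  qed
  ultimately show ?thesis using that by blast
qed

text \<open>Two indices of a block differ by some \<open>n\<close> with \<open>0 < n < N\<close>,
  and the difference of the two fractional parts is \<open>n * \<alpha>\<close> up to sign and an
  integer.\<close>

lemma orbit_separated:
  assumes c: "c > 0" "\<And>n. n \<ge> 1 \<Longrightarrow> c \<le> real n * dist_int (real n * \<alpha>)"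
    and ij: "i \<in> {N..<2*N}" "j \<in> {N..<2*N}" "i \<noteq> j"
  shows "c / real N \<le> \<bar>frac (y - real i * \<alpha>) - frac (y - real j * \<alpha>)\<bar>"
proof -
  have *: "c / real N \<le> \<bar>frac (y - real i * \<alpha>) - frac (y - real j * \<alpha>)\<bar>"
    if ij: "i \<in> {N..<2*N}" "j \<in> {N..<2*N}" "i < j" for i j
  proof -
    define n where "n = j - i"
    have n: "n \<ge> 1" "n \<le> N" using ij by (auto simp: n_def)
    have nr: "real n = real j - real i" using ij by (simp add: n_def)
    let ?k = "\<lfloor>y - real i * \<alpha>\<rfloor> - \<lfloor>y - real j * \<alpha>\<rfloor>"
    have "c / real N \<le> c / real n" using n c by (intro divide_left_mono) auto
    also have "\<dots> \<le> dist_int (real n * \<alpha>)"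
      using c(2)[OF n(1)] n by (simp add: field_simps)
    also have "\<dots> \<le> \<bar>real n * \<alpha> - of_int ?k\<bar>" by (rule dist_int_le)
    also have "real n * \<alpha> - of_int ?k = frac (y - real i * \<alpha>) - frac (y - real j * \<alpha>)"
      unfolding frac_def nr by (simp add: algebra_simps)
    finally show ?thesis .
  qed
  show ?thesis
    using *[of i j] *[of j i] ij by (cases "i < j") (auto simp: abs_minus_commute)
qed

text \<open>With a convergent \<open>h/k\<close> of denominator \<open>k \<le> N\<close>, the points \<open>i \<alpha>\<close> of a run of \<open>k\<close>
  consecutive indices are \<open>1/k\<close>-close to the points of a translate of \<open>(1/k)\<int>/\<int>\<close>;
  bad approximability forces \<open>k > c N\<close>.\<close>
lemma orbit_dense:
  assumes c: "c > 0" "\<And>n. n \<ge> 1 \<Longrightarrow> c \<le> real n * dist_int (real n * \<alpha>)"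
    and N: "N \<ge> 1" and z: "2 / c / real N < z" "z < 1 - 2 / c / real N"
  shows "\<exists>i\<in>{N..<2*N}. \<bar>z - frac (y - real i * \<alpha>)\<bar> \<le> 2 / c / real N"
proof -
  obtain h k where hk: "coprime h k" "0 < k" "k \<le> int N" "\<bar>of_int k * \<alpha> - of_int h\<bar> < 1 / real N"
    using Dirichlet_approx_coprime[of N \<alpha>] N by auto
  have k0: "real_of_int k > 0" using hk by simp
  have N0: "real N > 0" using N by simp
  have "c \<le> of_int k * dist_int (of_int k * \<alpha>)"
    using c(2)[of "nat k"] hk by simp
  also have "\<dots> \<le> of_int k * \<bar>of_int k * \<alpha> - of_int h\<bar>"
    using k0 by (intro mult_left_mono dist_int_le) auto
  also have "\<dots> < of_int k * (1 / real N)"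
    using k0 hk by (intro mult_strict_left_mono) auto
  finally have kN: "c * real N < of_int k" using N0 by (simp add: field_simps)
  define w where "w = y - real N * \<alpha>"
  \<comment> \<open>The point with index \<open>N + s\<close> is close to
    \<open>w - s * h / k\<close> modulo 1. As \<open>t / k\<close> approximates
    \<open>w - z\<close>, an \<open>s\<close> with \<open>s * h\<close> congruent to
    \<open>t\<close> modulo \<open>k\<close> brings it near \<open>z\<close>; the Bezout coefficient
    \<open>u\<close> inverts \<open>h\<close>.\<close>
  define t where "t = \<lfloor>of_int k * (w - z)\<rfloor>"
  obtain u v where uv: "u * h + v * k = 1"
    using bezout_int[of h k] hk(1) by auto
  define s where "s = (u * t) mod k"
  have s: "0 \<le> s" "s < k" using hk by (auto simp: s_def)
  have "k dvd s - u * t" unfolding s_def by (simp add: mod_eq_dvd_iff[symmetric])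
  then obtain l0 where l0: "s - u * t = k * l0" by auto
  define l where "l = l0 * h - t * v"
  have st: "s * h - k * l = t"
  proof -
    have "s * h - k * l = u * t * h + k * l0 * h - k * l0 * h + t * v * k"
      using l0 by (simp add: l_def algebra_simps)
    also have "\<dots> = t * (u * h + v * k)" by (simp add: algebra_simps)
    finally show ?thesis using uv by simp
  qed
  define i where "i = N + nat s"
  have i: "i \<in> {N..<2*N}" using s hk by (auto simp: i_def)
  have ri: "real i = real N + of_int s" using s by (simp add: i_def)
  define \<beta> where "\<beta> = of_int k * \<alpha> - of_int h"
  have \<alpha>: "of_int k * \<alpha> = of_int h + \<beta>" by (simp add: \<beta>_def)
  define e where "e = z - (y - real i * \<alpha>) - of_int l"
  have str: "of_int s * of_int h - of_int k * of_int l = real_of_int t"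
    using st by (metis of_int_diff of_int_mult)
  have "of_int k * e = of_int k * (z - w) + of_int s * (of_int k * \<alpha>) - of_int k * of_int l"
    by (simp add: e_def w_def ri algebra_simps)
  also have "\<dots> = (of_int t - of_int k * (w - z)) + of_int s * \<beta>"
    unfolding \<alpha> by (simp add: str[symmetric] algebra_simps)
  finally have ke: "of_int k * e = (of_int t - of_int k * (w - z)) + of_int s * \<beta>" .
  \<comment> \<open>Rounding, and the drift of \<open>\<alpha>\<close> from \<open>h / k\<close>
    over fewer than \<open>N\<close> steps, contribute at most 1 each; hence the 2 in
    \<open>2 / c / real N\<close>.\<close>
  have "\<bar>of_int t - of_int k * (w - z)\<bar> \<le> 1" unfolding t_def by linarith
  moreover have "\<bar>of_int s * \<beta>\<bar> \<le> 1"
  proof -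
    have "\<bar>of_int s * \<beta>\<bar> = of_int s * \<bar>\<beta>\<bar>" using s by (simp add: abs_mult)
    also have "\<dots> \<le> real N * (1 / real N)"
      using s hk unfolding \<beta>_def by (intro mult_mono) auto
    finally show ?thesis using N0 by simp
  qed
  ultimately have "\<bar>of_int k * e\<bar> \<le> 2" unfolding ke by linarith
  then have "of_int k * \<bar>e\<bar> \<le> 2" using k0 by (simp add: abs_mult)
  then have "\<bar>e\<bar> \<le> 2 / of_int k" using k0 by (simp add: field_simps)
  also have "\<dots> \<le> 2 / (c * real N)"
    using kN c(1) N0 k0 by (intro divide_left_mono) auto
  finally have e: "\<bar>e\<bar> \<le> 2 / c / real N" by simp
  let ?p = "frac (y - real i * \<alpha>)"
  \<comment> \<open>So far \<open>z\<close> is approximated modulo 1. Its distance from both ends of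
    the unit interval excludes every shift \<open>m\<close> except 0.\<close>
  define m where "m = l + \<lfloor>y - real i * \<alpha>\<rfloor>"
  have em: "e = z - ?p - of_int m" by (simp add: e_def m_def frac_def)
  have "0 \<le> ?p" "?p < 1" by (auto simp: frac_lt_1)
  then have "real_of_int m < 1" "real_of_int m > -1" using e z em by linarith+
  then have "m = 0" by linarith
  then have "e = z - ?p" unfolding em by (simp only: of_int_0 diff_0_right)
  with e have "\<bar>z - ?p\<bar> \<le> 2 / c / real N" by metis
  with i show ?thesis by blast
qed

section \<open>Measure removed by one block of intervals\<close>

lemma interval_length_lebesgue [simp]:
  fixes a b :: real
  shows "measure lebesgue {a<..<b} = max 0 (b - a)" "measure lebesgue {a..b} = max 0 (b - a)"
  by (cases "a \<le> b"; simp)+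

text \<open>The set \<open>I\<close> of new intervals lying inside \<open>G\<close> links both sides: enlarged to radius \<open>\<delta>\<close>
  they cover \<open>G\<close> up to a neighbourhood of its boundary, and they are disjoint subsets of \<open>G\<close>
  missing from \<open>G'\<close>.\<close>
lemma removed_intervals_measure:
  fixes p :: "'a \<Rightarrow> real" and q r :: "'b \<Rightarrow> real"
  assumes "finite K" "finite B" "\<rho> > 0" "\<delta> \<ge> 0"
    and dense: "\<And>z. \<delta> < z \<Longrightarrow> z < 1 - \<delta> \<Longrightarrow> \<exists>i\<in>B. \<bar>z - p i\<bar> \<le> \<delta>"
    and sep: "\<And>i j. i \<in> B \<Longrightarrow> j \<in> B \<Longrightarrow> i \<noteq> j \<Longrightarrow> 2 * \<rho> \<le> \<bar>p i - p j\<bar>"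
  defines "G \<equiv> {0<..<1} - (\<Union>k\<in>K. {q k - r k<..<q k + r k})"
  defines "G' \<equiv> G - (\<Union>i\<in>B. {p i - \<rho><..<p i + \<rho>})"
  shows "\<rho> * (measure lebesgue G - 2 * (real (card K) + 1) * (\<delta> + \<rho>))
           \<le> \<delta> * (measure lebesgue G - measure lebesgue G')"
proof -
  define D where "D = \<delta> + \<rho>"
  have D: "D > 0" using assms by (simp add: D_def)
  define I where "I = {i\<in>B. {p i - \<rho><..<p i + \<rho>} \<subseteq> G}"
  have fI: "finite I" using assms(2) by (simp add: I_def)
  \<comment> \<open>Strips of width \<open>\<delta> + \<rho>\<close> at the possible boundary points
    of \<open>G\<close>. A point of \<open>G\<close> outside them has a centre within
    \<open>\<delta>\<close>, whose interval of radius \<open>\<rho>\<close> then stays inside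
    \<open>G\<close>.\<close>
  define bad where "bad = {0..D} \<union> {1-D..1} \<union>
    (\<Union>k\<in>K. {q k - r k - D..q k - r k} \<union> {q k + r k..q k + r k + D})"
  define cov where "cov = (\<Union>i\<in>I. {p i - \<delta>..p i + \<delta>})"
  have G_sets: "G \<in> lmeasurable" unfolding G_def
    by (intro fmeasurable_Diff sets.finite_UN assms(1)) auto
  then have G'_sets: "G' \<in> lmeasurable" unfolding G'_def
    by (intro fmeasurable_Diff sets.finite_UN assms(2)) auto
  have bad_m: "bad \<in> lmeasurable" unfolding bad_def
    by (intro fmeasurable.Un fmeasurable.finite_UN assms(1)) auto
  have cov_m: "cov \<in> lmeasurable" unfolding cov_def
    by (intro fmeasurable.finite_UN fI) auto
  have sub: "G \<subseteq> cov \<union> bad"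
  proof
    fix x assume x: "x \<in> G"
    show "x \<in> cov \<union> bad"
    proof (rule ccontr)
      assume nx: "x \<notin> cov \<union> bad"
      from x have x01: "0 < x" "x < 1" by (auto simp: G_def)
      with nx have xD: "D < x" "x < 1 - D" by (auto simp: bad_def)
      have far: "r k + D \<le> \<bar>x - q k\<bar>" if "k \<in> K" for k
      proof -
        have "x \<notin> {q k - r k<..<q k + r k}" using x that by (auto simp: G_def)
        moreover have "x \<notin> {q k - r k - D..q k - r k}" "x \<notin> {q k + r k..q k + r k + D}"
          using nx that by (auto simp: bad_def)
        ultimately show ?thesis using D by auto
      qed
      obtain i where i: "i \<in> B" "\<bar>x - p i\<bar> \<le> \<delta>"
        using dense[of x] xD assms(3) by (auto simp: D_def)
      have "{p i - \<rho><..<p i + \<rho>} \<subseteq> G"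
      proof
        fix y assume y: "y \<in> {p i - \<rho><..<p i + \<rho>}"
        then have yx: "\<bar>y - x\<bar> < D" using i by (auto simp: D_def)
        have "y \<notin> {q k - r k<..<q k + r k}" if "k \<in> K" for k
          using far[OF that] yx by auto
        moreover have "y \<in> {0<..<1}" using xD yx by auto
        ultimately show "y \<in> G" by (auto simp: G_def)
      qed
      then have "x \<in> cov" using i by (auto simp: cov_def I_def)
      with nx show False by simp
    qed
  qed
  have "measure lebesgue cov \<le> (\<Sum>i\<in>I. measure lebesgue {p i - \<delta>..p i + \<delta>})"
    unfolding cov_def by (intro measure_UNION_le fI) auto
  also have "\<dots> = real (card I) * (2 * \<delta>)" using assms(4) by simp
  finally have cov_le: "measure lebesgue cov \<le> real (card I) * (2 * \<delta>)" .
  have "measure lebesgue (\<Union>k\<in>K. {q k - r k - D..q k - r k} \<union> {q k + r k..q k + r k + D})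
      \<le> (\<Sum>k\<in>K. measure lebesgue ({q k - r k - D..q k - r k} \<union> {q k + r k..q k + r k + D}))"
    by (intro measure_UNION_le assms(1)) auto
  also have "\<dots> \<le> (\<Sum>k\<in>K. 2 * D)"
    using D by (intro sum_mono order_trans[OF measure_Un_le]) auto
  finally have U_le: "measure lebesgue (\<Union>k\<in>K. {q k - r k - D..q k - r k} \<union> {q k + r k..q k + r k + D})
      \<le> real (card K) * (2 * D)" by simp
  have "measure lebesgue bad \<le> measure lebesgue ({0..D} \<union> {1-D..1}) + real (card K) * (2 * D)"
    unfolding bad_def
    by (rule order_trans[OF measure_Un_le]) (use U_le assms(1) in \<open>auto intro!: sets.finite_UN\<close>)
  moreover have "measure lebesgue ({0..D} \<union> {1-D..1}) \<le> 2 * D"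
    using D by (intro order_trans[OF measure_Un_le]) auto
  ultimately have bad_le: "measure lebesgue bad \<le> 2 * (real (card K) + 1) * D"
    by (simp add: algebra_simps)
  have "measure lebesgue G \<le> measure lebesgue (cov \<union> bad)"
    using sub G_sets cov_m bad_m by (intro measure_mono_fmeasurable) (auto intro: fmeasurable.Un)
  also have "\<dots> \<le> measure lebesgue cov + measure lebesgue bad"
    using cov_m bad_m by (intro measure_Un_le) auto
  finally have upper: "measure lebesgue G - 2 * (real (card K) + 1) * D \<le> real (card I) * (2 * \<delta>)"
    using cov_le bad_le by linarith

  define U where "U = (\<Union>i\<in>I. {p i - \<rho><..<p i + \<rho>})"
  have U_m: "U \<in> lmeasurable" unfolding U_def
    by (intro fmeasurable.finite_UN fI) auto
  have disj: "disjoint_family_on (\<lambda>i. {p i - \<rho><..<p i + \<rho>}) I"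
  proof (unfold disjoint_family_on_def, intro ballI impI)
    fix i j assume "i \<in> I" "j \<in> I" "i \<noteq> j"
    then have "2 * \<rho> \<le> \<bar>p i - p j\<bar>" using sep by (auto simp: I_def)
    then show "{p i - \<rho><..<p i + \<rho>} \<inter> {p j - \<rho><..<p j + \<rho>} = {}" by auto
  qed
  have "measure lebesgue U = (\<Sum>i\<in>I. measure lebesgue {p i - \<rho><..<p i + \<rho>})"
    unfolding U_def using assms(3) by (intro measure_finite_Union[OF fI _ disj]) auto
  also have "\<dots> = real (card I) * (2 * \<rho>)" using assms(3) by simp
  finally have U_eq: "measure lebesgue U = real (card I) * (2 * \<rho>)" .
  have "measure lebesgue G' + measure lebesgue U = measure lebesgue (G' \<union> U)"
    using G'_sets U_m
    by (intro measure_Union[symmetric]) (auto simp: G'_def U_def I_def fmeasurable_def)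
  also have "\<dots> \<le> measure lebesgue G"
    using G_sets G'_sets U_m
    by (intro measure_mono_fmeasurable) (auto simp: G'_def U_def I_def)
  finally have lower: "real (card I) * (2 * \<rho>) \<le> measure lebesgue G - measure lebesgue G'"
    using U_eq by linarith
  \<comment> \<open>Both estimates involve \<open>card I\<close>; cross-multiplication eliminates
    it.\<close>
  have "\<rho> * (measure lebesgue G - 2 * (real (card K) + 1) * D) \<le> \<rho> * (real (card I) * (2 * \<delta>))"
    using upper assms(3) by (intro mult_left_mono) auto
  also have "\<dots> = \<delta> * (real (card I) * (2 * \<rho>))" by simp
  also have "\<dots> \<le> \<delta> * (measure lebesgue G - measure lebesgue G')"
    using lower assms(4) by (intro mult_left_mono) auto
  finally show ?thesis by (simp add: D_def)
qed

section \<open>Cauchy condensation of the radii\<close>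

text \<open>The stretch from \<open>2*Q^j\<close> to \<open>2*Q^(j+1)\<close> has fewer than
  \<open>2*Q*Q^j\<close> terms, each at most the first. The sample points are \<open>2*Q^j\<close>
  because the value there is a lower bound for all radii with index in
  \<open>{Q^j..<2*Q^j}\<close>.\<close>

lemma sum_le_condensed:
  fixes a :: "nat \<Rightarrow> real"
  assumes mono: "antimono_on {1..} a" and Q: "Q \<ge> 1"
    and pos: "\<And>i. i \<ge> 1 \<Longrightarrow> a i \<ge> 0" and "k \<le> n"
  shows "(\<Sum>i=2*Q^k..<2*Q^n. a i) \<le> 2 * real Q * (\<Sum>j=k..<n. real Q ^ j * a (2*Q^j))"
  using \<open>k \<le> n\<close>
proof (induction n rule: dec_induct)
  case base
  then show ?case by simp
next
  case (step n)
  have le: "2*Q^n \<le> 2*Q^Suc n" "2*Q^k \<le> 2*Q^n"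
    using Q step.hyps by (auto intro!: power_increasing)
  have Qn: "Q^n \<ge> 1" using Q by simp
  have "(\<Sum>i=2*Q^n..<2*Q^Suc n. a i) \<le> (\<Sum>i=2*Q^n..<2*Q^Suc n. a (2*Q^n))"
    using Qn by (intro sum_mono monotone_onD[OF mono]) auto
  also have "\<dots> = real (2*Q^Suc n - 2*Q^n) * a (2*Q^n)" by simp
  also have "\<dots> \<le> real (2*Q^Suc n) * a (2*Q^n)"
    using pos[of "2*Q^n"] Qn by (intro mult_right_mono of_nat_mono) auto
  finally have "(\<Sum>i=2*Q^n..<2*Q^Suc n. a i) \<le> 2 * real Q * (real Q ^ n * a (2*Q^n))"
    by simp
  moreover have "(\<Sum>i=2*Q^k..<2*Q^Suc n. a i) = (\<Sum>i=2*Q^k..<2*Q^n. a i) + (\<Sum>i=2*Q^n..<2*Q^Suc n. a i)"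
    using le by (subst sum.atLeastLessThan_concat) auto
  ultimately show ?case using step by (simp add: algebra_simps)
qed

text \<open>The cap \<open>d\<close> will keep the removed intervals disjoint. It cannot create
  convergence: summable terms tend to 0, so the cap would be inactive from some \<open>K\<close> on,
  and condensation would bound the partial sums of \<open>a\<close>.\<close>

lemma condensed_min_not_summable:
  fixes a :: "nat \<Rightarrow> real"
  assumes mono: "antimono_on {1..} a" and Q: "Q \<ge> 2" and d: "d > 0"
    and pos: "\<And>i. i \<ge> 1 \<Longrightarrow> a i > 0"
    and div: "filterlim (\<lambda>n. \<Sum>i=1..n. a i) at_top sequentially"
  shows "\<not> summable (\<lambda>k. min (real Q ^ k * a (2*Q^k)) d)"
proof
  let ?s = "\<lambda>k. min (real Q ^ k * a (2*Q^k)) d"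
  assume sm: "summable ?s"
  have Q1: "Q^k \<ge> 1" for k using Q by simp
  have s0: "?s k \<ge> 0" for k using d pos[of "2*Q^k"] Q1[of k] by simp
  have "eventually (\<lambda>k. ?s k < d) sequentially"
    using summable_LIMSEQ_zero[OF sm] d by (rule order_tendstoD)
  then obtain K where "\<And>k. k \<ge> K \<Longrightarrow> ?s k < d"
    unfolding eventually_sequentially by blast
  then have K: "?s k = real Q ^ k * a (2*Q^k)" if "k \<ge> K" for k
    using that by (fastforce simp: min_less_iff_disj)
  have bound: "(\<Sum>i=1..n. a i) \<le> (\<Sum>i=1..<2*Q^K. a i) + 2 * real Q * suminf ?s" for n
  proof -
    define n' where "n' = max K n"
    have "n < 2^n" by (rule less_exp)
    also have "(2::nat)^n \<le> Q^n" using Q by (intro power_mono) auto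
    also have "\<dots> \<le> Q^n'" using Q by (intro power_increasing) (auto simp: n'_def)
    finally have n: "n < 2*Q^n'" by simp
    have le: "2*Q^K \<le> 2*Q^n'" using Q by (auto simp: n'_def intro!: power_increasing)
    have "(\<Sum>i=1..n. a i) \<le> (\<Sum>i=1..<2*Q^n'. a i)"
      using n pos by (intro sum_mono2) (auto intro: less_imp_le)
    also have "\<dots> = (\<Sum>i=1..<2*Q^K. a i) + (\<Sum>i=2*Q^K..<2*Q^n'. a i)"
      using le Q1[of K] by (subst sum.atLeastLessThan_concat) auto
    also have "(\<Sum>i=2*Q^K..<2*Q^n'. a i) \<le> 2 * real Q * (\<Sum>j=K..<n'. real Q ^ j * a (2*Q^j))"
      using Q by (intro sum_le_condensed[OF mono] less_imp_le[OF pos]) (auto simp: n'_def)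
    also have "(\<Sum>j=K..<n'. real Q ^ j * a (2*Q^j)) = (\<Sum>j=K..<n'. ?s j)"
      by (intro sum.cong refl K[symmetric]) simp
    also have "\<dots> \<le> suminf ?s"
      using sm s0 by (intro sum_le_suminf) auto
    finally show ?thesis using Q by simp
  qed
  have "eventually (\<lambda>n. (\<Sum>i=1..<2*Q^K. a i) + 2 * real Q * suminf ?s + 1 \<le> (\<Sum>i=1..n. a i)) sequentially"
    using div unfolding filterlim_at_top by blast
  then obtain n where "(\<Sum>i=1..<2*Q^K. a i) + 2 * real Q * suminf ?s + 1 \<le> (\<Sum>i=1..n. a i)"
    by (auto simp: eventually_sequentially)
  with bound[of n] show False by linarith
qed

text \<open>The sum counts the intervals removed before stage \<open>n\<close>. They are few
  compared to the \<open>Q^n\<close> new ones once \<open>Q\<close> is large, which keeps boundary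
  effects small.\<close>

lemma geometric_sum_le:
  fixes Q :: nat
  assumes "Q \<ge> 2" "n \<ge> 1"
  shows "Q * ((\<Sum>k<n. Q^k) + 1) \<le> 2 * Q^n"
  using assms(2)
proof (induction n rule: dec_induct)
  case base
  then show ?case by simp
next
  case (step n)
  have "Q * ((\<Sum>k<Suc n. Q^k) + 1) = Q * ((\<Sum>k<n. Q^k) + 1) + Q * Q^n"
    by (simp add: algebra_simps)
  also have "\<dots> \<le> 2 * Q^n + Q * Q^n" using step by simp
  also have "\<dots> \<le> Q * Q^n + Q * Q^n" using assms(1) by simp
  finally show ?case by simp
qed

section \<open>Kurzweil's theorem for evenly spaced points\<close>

text \<open>Separation and density at scale \<open>1/N\<close> are all that is taken from the
  rotation. The avoiding set survives every removal, so its measure \<open>g\<close> bounds every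
  \<open>\<mu> n\<close> from below, whereas the drops of \<open>\<mu>\<close> would have an
  infinite sum if \<open>g > 0\<close>.\<close>

lemma borel_cantelli_evenly_spaced:
  fixes p a :: "nat \<Rightarrow> real"
  assumes c: "c > 0" and C: "C > 0"
    and sep: "\<And>N i j. i \<in> {N..<2*N} \<Longrightarrow> j \<in> {N..<2*N} \<Longrightarrow> i \<noteq> j \<Longrightarrow> c / real N \<le> \<bar>p i - p j\<bar>"
    and dense: "\<And>N z. N \<ge> 1 \<Longrightarrow> C / real N < z \<Longrightarrow> z < 1 - C / real N \<Longrightarrow>
                  \<exists>i\<in>{N..<2*N}. \<bar>z - p i\<bar> \<le> C / real N"
    and pos: "\<And>i. i \<ge> 1 \<Longrightarrow> a i > 0"
    and mono: "antimono_on {1..} a"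
    and div: "filterlim (\<lambda>n. \<Sum>i=1..n. a i) at_top sequentially"
  shows "{x\<in>{0<..<1}. \<forall>i\<ge>m. a i \<le> \<bar>x - p i\<bar>} \<in> null_sets lebesgue"
proof -
  define G where "G = {x\<in>{0<..<1}. \<forall>i\<ge>m. a i \<le> \<bar>x - p i\<bar>}"
  have G_eq: "G = {0<..<1} \<inter> (\<Inter>i\<in>{m..}. {x. a i \<le> \<bar>x - p i\<bar>})"
    by (auto simp: G_def)
  have "closed (\<Inter>i\<in>{m..}. {x. a i \<le> \<bar>x - p i\<bar>})"
    by (intro closed_INT ballI closed_Collect_le continuous_intros)
  then have "G \<in> sets borel" unfolding G_eq by (intro sets.Int) (auto intro: borel_closed)
  then have G_m: "G \<in> lmeasurable"
    by (intro bounded_set_imp_lmeasurable bounded_subset[of "{0<..<1}" G]) (auto simp: G_def)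
  have "measure lebesgue G = 0"
  proof (rule ccontr)
    assume "measure lebesgue G \<noteq> 0"
    define g where "g = measure lebesgue G"
    have g: "g > 0" using \<open>measure lebesgue G \<noteq> 0\<close> by (simp add: g_def zero_less_measure_iff)
    \<comment> \<open>The factor 8 makes the boundary loss of each stage, at most
      \<open>4 * (C + c) / Q\<close>, no larger than \<open>g / 2\<close>.\<close>
    obtain Q0 :: nat where Q0: "8 * (C + c) / g \<le> real Q0" using real_arch_simple by blast
    define Q where "Q = max 2 Q0"
    have Q: "Q \<ge> 2" "8 * (C + c) / g \<le> real Q" using Q0 by (auto simp: Q_def)
    have Q1: "Q^k \<ge> 1" for k using Q by simp
    have Q1': "real Q^k > 0" for k using Q by simp
    \<comment> \<open>\<open>\<rho> k\<close> serves the whole block \<open>{Q^k..<2*Q^k}\<close>: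
      it is at most every \<open>a i\<close> there and at most half the separation
      \<open>c / Q^k\<close>. \<open>s k\<close> is this radius scaled by
      \<open>Q^k\<close>.\<close>
    define s where "s = (\<lambda>k. min (real Q ^ k * a (2*Q^k)) (c/2))"
    define \<rho> where "\<rho> = (\<lambda>k. s k / real Q ^ k)"
    have s0: "s k > 0" for k using c pos[of "2*Q^k"] Q1[of k] Q1'[of k] by (simp add: s_def)
    then have \<rho>0: "\<rho> k > 0" for k using Q1' by (simp add: \<rho>_def)
    have \<rho>a: "\<rho> k \<le> a (2*Q^k)" for k
      using Q1'[of k] by (simp add: \<rho>_def s_def field_simps)
    have \<rho>c: "\<rho> k \<le> c / 2 / real Q ^ k" for k
      unfolding \<rho>_def using Q1'[of k] by (intro divide_right_mono) (auto simp: s_def)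
    \<comment> \<open>All indices from block \<open>n0\<close> on exceed \<open>m\<close>, since
      \<open>Q^k \<ge> 2^m\<close>. The successor also gives \<open>n0 \<ge> 1\<close>, as
      \<open>geometric_sum_le\<close> requires.\<close>
    define n0 where "n0 = Suc m"
    have n0: "i \<ge> m" "i \<ge> 1" if "n0 \<le> k" "i \<ge> Q^k" for i k
    proof -
      have "m < 2^m" by (rule less_exp)
      also have "(2::nat)^m \<le> Q^m" using Q by (intro power_mono) auto
      also have "\<dots> \<le> Q^k" using Q that by (intro power_increasing) (auto simp: n0_def)
      finally show "i \<ge> m" "i \<ge> 1" using that by auto
    qed
    define B where "B = (\<lambda>k. {Q^k..<2*Q^k})"
    \<comment> \<open>The stage is stored with the index because the radius depends on the
      stage.\<close>
    define K where "K = (\<lambda>n. Sigma {n0..<n} B)"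
    define H where "H = (\<lambda>n. {0<..<1} - (\<Union>k\<in>K n. {p (snd k) - \<rho> (fst k)<..<p (snd k) + \<rho> (fst k)}))"
    define \<mu> where "\<mu> = (\<lambda>n. measure lebesgue (H n))"
    have fK: "finite (K n)" for n by (auto simp: K_def B_def)
    have H_Suc: "H (Suc n) = H n - (\<Union>i\<in>B n. {p i - \<rho> n<..<p i + \<rho> n})" if "n \<ge> n0" for n
    proof -
      have "K (Suc n) = K n \<union> (\<lambda>i. (n, i)) ` B n"
        using that by (auto simp: K_def less_Suc_eq)
      then show ?thesis by (auto simp: H_def)
    qed
    have H_m: "H n \<in> lmeasurable" for n unfolding H_def
      by (intro fmeasurable_Diff sets.finite_UN fK) auto
    have G_sub: "G \<subseteq> H n" for n
    proof
      fix x assume x: "x \<in> G"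
      have "\<rho> k \<le> \<bar>x - p i\<bar>" if "n0 \<le> k" "i \<in> B k" for k i
      proof -
        have i: "i \<ge> m" "i \<ge> 1" using n0[of k i] that by (auto simp: B_def)
        have "\<rho> k \<le> a (2*Q^k)" by (rule \<rho>a)
        also have "\<dots> \<le> a i"
          using that i by (intro monotone_onD[OF mono]) (auto simp: B_def)
        also have "\<dots> \<le> \<bar>x - p i\<bar>" using x i by (simp add: G_def)
        finally show ?thesis .
      qed
      then have "x \<notin> {p i - \<rho> k<..<p i + \<rho> k}" if "(k, i) \<in> K n" for k i
        using that by (fastforce simp: K_def abs_if split: if_splits)
      then show "x \<in> H n" using x by (auto simp: H_def G_def)
    qed
    have \<mu>g: "g \<le> \<mu> n" for n unfolding g_def \<mu>_def
      using G_m H_m G_sub by (intro measure_mono_fmeasurable) auto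
    \<comment> \<open>At most half of \<open>g\<close> is lost near the boundary, so the rest forces
      a drop of at least \<open>s n * g / (2 * C)\<close>.\<close>
    have step: "s n * (g / 2) \<le> C * (\<mu> n - \<mu> (Suc n))" if n: "n \<ge> n0" for n
    proof -
      let ?N = "real Q ^ n" and ?\<delta> = "C / real Q ^ n"
      have N: "?N > 0" by (rule Q1')
      have "card (K n) = (\<Sum>k\<in>{n0..<n}. Q^k)" by (simp add: K_def B_def)
      also have "\<dots> \<le> (\<Sum>k<n. Q^k)" by (intro sum_mono2) auto
      finally have "Q * (card (K n) + 1) \<le> Q * ((\<Sum>k<n. Q^k) + 1)" by (intro mult_left_mono) auto
      also have "\<dots> \<le> 2 * Q^n" using Q n by (intro geometric_sum_le) (auto simp: n0_def)
      finally have "real (Q * (card (K n) + 1)) \<le> real (2 * Q^n)" by (simp only: of_nat_le_iff)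
      then have card: "real (card (K n)) + 1 \<le> 2 * ?N / real Q"
        using Q by (simp add: field_simps)
      have "?\<delta> + \<rho> n \<le> (C + c) / ?N"
        using \<rho>c[of n] c N by (simp add: field_simps)
      then have "2 * (real (card (K n)) + 1) * (?\<delta> + \<rho> n) \<le> 2 * (2 * ?N / real Q) * ((C + c) / ?N)"
        using card \<rho>0[of n] C N by (intro mult_mono) (auto simp: less_imp_le)
      also have "\<dots> = 4 * (C + c) / real Q" using N by simp
      also have "\<dots> \<le> g / 2" using Q g by (simp add: field_simps)
      finally have small: "2 * (real (card (K n)) + 1) * (?\<delta> + \<rho> n) \<le> g / 2" .
      have "\<rho> n * (\<mu> n - 2 * (real (card (K n)) + 1) * (?\<delta> + \<rho> n)) \<le> ?\<delta> * (\<mu> n - \<mu> (Suc n))"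
        unfolding \<mu>_def H_Suc[OF n] unfolding H_def
      proof (rule removed_intervals_measure)
        show "\<exists>i\<in>B n. \<bar>z - p i\<bar> \<le> ?\<delta>" if "?\<delta> < z" "z < 1 - ?\<delta>" for z
          using dense[of "Q^n" z] Q1[of n] that by (simp add: B_def)
        show "2 * \<rho> n \<le> \<bar>p i - p j\<bar>" if "i \<in> B n" "j \<in> B n" "i \<noteq> j" for i j
          using sep[of i "Q^n" j] \<rho>c[of n] that by (simp add: B_def)
      qed (use fK \<rho>0 C N in \<open>auto simp: B_def\<close>)
      moreover have "\<rho> n * (g / 2) \<le> \<rho> n * (\<mu> n - 2 * (real (card (K n)) + 1) * (?\<delta> + \<rho> n))"
        using small \<mu>g[of n] \<rho>0[of n] by (intro mult_left_mono) auto
      ultimately have "\<rho> n * (g / 2) \<le> ?\<delta> * (\<mu> n - \<mu> (Suc n))" by linarith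
      then have "?N * (\<rho> n * (g / 2)) \<le> ?N * (?\<delta> * (\<mu> n - \<mu> (Suc n)))"
        using N by (intro mult_left_mono) auto
      then show ?thesis using Q(1) by (simp add: \<rho>_def)
    qed
    \<comment> \<open>The drops telescope to at most \<open>\<mu> n0\<close>, so \<open>s\<close>
      would be summable, against condensation.\<close>
    have "(\<Sum>k<n. s (k + n0)) \<le> C * \<mu> n0 / (g / 2)" for n
    proof -
      have "(\<Sum>k<n. s (k + n0)) * (g / 2) \<le> (\<Sum>k<n. C * (\<mu> (k + n0) - \<mu> (Suc k + n0)))"
        unfolding sum_distrib_right using step by (intro sum_mono) simp
      also have "\<dots> = C * (\<mu> n0 - \<mu> (n + n0))"
        by (simp only: sum_distrib_left[symmetric] sum_lessThan_telescope'[where f = "\<lambda>k. \<mu> (k + n0)"]) simp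
      also have "\<dots> \<le> C * \<mu> n0" using C \<mu>g[of "n + n0"] g by simp
      finally show ?thesis using g by (simp add: field_simps)
    qed
    then have "summable (\<lambda>k. s (k + n0))"
      using s0 by (intro summableI_nonneg_bounded) (auto intro: less_imp_le)
    then have "summable s" by (simp add: summable_iff_shift)
    then show False
      using condensed_min_not_summable[OF mono Q(1) _ pos div, of "c/2"] c by (simp add: s_def)
  qed
  then show ?thesis
    using G_m unfolding G_def[symmetric]
    by (simp add: null_sets_def emeasure_eq_measure2 fmeasurableD)
qed

section \<open>Measurability and iterates of the skew product\<close>

text \<open>An image under \<open>frac\<close> is not visibly Borel; undoing the reduction modulo 1
  turns it into a countable union of preimages under translations.\<close>

lemma J'_set_eq:
  "J'_set \<alpha> = {0..<1} \<inter> (\<Union>k::int. {x. x + of_int k - y_inf \<alpha> \<in> J_set \<alpha>})"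
proof (intro equalityI subsetI)
  fix x assume "x \<in> J'_set \<alpha>"
  then obtain u where u: "u \<in> J_set \<alpha>" "x = frac (y_inf \<alpha> + u)" by (auto simp: J'_set_def)
  then have "x + of_int \<lfloor>y_inf \<alpha> + u\<rfloor> - y_inf \<alpha> = u" by (simp add: frac_def)
  with u show "x \<in> {0..<1} \<inter> (\<Union>k::int. {x. x + of_int k - y_inf \<alpha> \<in> J_set \<alpha>})"
    by (auto simp: frac_lt_1 intro!: exI[of _ "\<lfloor>y_inf \<alpha> + u\<rfloor>"])
next
  fix x assume "x \<in> {0..<1} \<inter> (\<Union>k::int. {x. x + of_int k - y_inf \<alpha> \<in> J_set \<alpha>})"
  then obtain k :: int where k: "0 \<le> x" "x < 1" "x + of_int k - y_inf \<alpha> \<in> J_set \<alpha>" by auto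
  moreover have "frac (y_inf \<alpha> + (x + of_int k - y_inf \<alpha>)) = x"
    using k by (simp add: frac_unique_iff)
  ultimately show "x \<in> J'_set \<alpha>" unfolding J'_set_def by (metis image_eqI)
qed

lemma J_sets_borel: "J_set \<alpha> \<union> J'_set \<alpha> \<in> sets borel"
proof -
  have [measurable]: "J_set \<alpha> \<in> sets borel" by (simp add: J_set_def)
  show ?thesis unfolding J'_set_eq by measurable
qed

text \<open>Borel sets on the base let the iterates be composed directly; only the sections of the
  limsup set are later viewed as Lebesgue sets.\<close>

lemma skew_T_measurable:
  "skew_T \<alpha> \<in> borel \<Otimes>\<^sub>M count_space UNIV \<rightarrow>\<^sub>M borel \<Otimes>\<^sub>M count_space UNIV"
proof -
  define S where "S = J_set \<alpha> \<union> J'_set \<alpha>"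
  have [measurable]: "S \<in> sets borel" unfolding S_def by (rule J_sets_borel)
  have [measurable]: "(\<lambda>i::bit. i + 1) \<in> count_space UNIV \<rightarrow>\<^sub>M count_space UNIV" by simp
  have "skew_T \<alpha> = (\<lambda>p. (frac (fst p + \<alpha>), if fst p \<in> S then snd p + 1 else snd p))"
    by (auto simp: skew_T_def S_def[symmetric] fun_eq_iff)
  also have "\<dots> \<in> borel \<Otimes>\<^sub>M count_space UNIV \<rightarrow>\<^sub>M borel \<Otimes>\<^sub>M count_space UNIV"
    unfolding frac_def by measurable
  finally show ?thesis .
qed

lemma preimage_T_Ball2_measurable:
  "preimage_T \<alpha> n (Ball2 (y, 0) r) \<in> sets (borel \<Otimes>\<^sub>M count_space UNIV)"
proof -
  have Ball2_eq: "Ball2 (y, 0) r = ({0..<1} \<inter> {x. dist_int (x - y) < r}) \<times> {0}"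
    by (auto simp: Ball2_def)
  have "open {x. dist_int (x - y) < r}"
    unfolding dist_int_def by (intro open_Collect_less continuous_intros)
  then have "Ball2 (y, 0) r \<in> sets (borel \<Otimes>\<^sub>M count_space UNIV)"
    unfolding Ball2_eq by (intro pair_measureI sets.Int) (auto intro: borel_open)
  moreover have "skew_T \<alpha> ^^ n \<in> borel \<Otimes>\<^sub>M count_space UNIV \<rightarrow>\<^sub>M borel \<Otimes>\<^sub>M count_space UNIV"
    by (rule measurable_compose_n[OF skew_T_measurable])
  ultimately have "(skew_T \<alpha> ^^ n) -` Ball2 (y, 0) r \<in> sets (borel \<Otimes>\<^sub>M count_space UNIV)"
    using measurable_sets[of "skew_T \<alpha> ^^ n"] by (fastforce simp: space_pair_measure)
  then show ?thesis unfolding preimage_T_def by (intro sets.Int pair_measureI) auto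
qed

text \<open>The cocycle is evaluated along the base orbit only, so \<open>s\<close> does not depend
  on \<open>j\<close>: hence the order of the quantifiers.\<close>

lemma skew_T_iterate:
  assumes "x \<in> {0..<1}"
  shows "\<exists>s. \<forall>j. (skew_T \<alpha> ^^ n) (x, j) = (frac (x + real n * \<alpha>), j + s)"
proof (induction n)
  case 0
  have "frac x = x" using assms by (simp add: frac_eq)
  then show ?case by (auto intro: exI[of _ 0])
next
  case (Suc n)
  then obtain s where s: "\<And>j. (skew_T \<alpha> ^^ n) (x, j) = (frac (x + real n * \<alpha>), j + s)" by blast
  have "frac (frac (x + real n * \<alpha>) + \<alpha>) = frac (x + real (Suc n) * \<alpha>)"
    by (simp add: frac_add_simps algebra_simps)
  then have "(skew_T \<alpha> ^^ Suc n) (x, j) = (frac (x + real (Suc n) * \<alpha>),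
      j + (s + indicator (J_set \<alpha> \<union> J'_set \<alpha>) (frac (x + real n * \<alpha>))))" for j
    unfolding funpow.simps o_apply s by (simp only: skew_T_def prod.case add.assoc)
  then show ?case by blast
qed

section \<open>From the rotation to the skew product\<close>

theorem proposition4:
  fixes \<alpha> :: real and a :: "nat \<Rightarrow> real"
  assumes "\<alpha> \<notin> \<rat>" and "0 < \<alpha>" and "\<alpha> < 1/3"
    and "badly_approximable \<alpha>"
    and "\<And>i. i \<ge> 1 \<Longrightarrow> a i > 0"
    and "antimono_on {1..} a"
    and "filterlim (\<lambda>n. \<Sum>i=1..n. a i) at_top sequentially"
  shows "\<forall>y\<in>{0..<1}.
    emeasure lambda2 (\<Inter>n\<in>{1..}. \<Union>i\<in>{n..}. preimage_T \<alpha> i (Ball2 (y, 0) (a i))) \<ge> 1"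
proof
  fix y :: real assume "y \<in> {0..<1}"
  obtain c where c: "c > 0" "\<And>n. n \<ge> 1 \<Longrightarrow> c \<le> real n * dist_int (real n * \<alpha>)"
    using badly_approximable_lower_bound[OF assms(1,4)] by blast
  define p where "p = (\<lambda>i. frac (y - real i * \<alpha>))"
  define Z where "Z = (\<Union>m. {x\<in>{0<..<1}. \<forall>i\<ge>m. a i \<le> \<bar>x - p i\<bar>})"
  have "{x\<in>{0<..<1}. \<forall>i\<ge>m. a i \<le> \<bar>x - p i\<bar>} \<in> null_sets lebesgue" for m
    by (rule borel_cantelli_evenly_spaced[OF c(1) _ _ _ assms(5-7), of "2 / c"])
       (use c orbit_separated[OF c] orbit_dense[OF c] in \<open>auto simp: p_def\<close>)
  then have Z: "Z \<in> null_sets lebesgue" unfolding Z_def by (intro null_sets_UN) auto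
  define L where "L = (\<Inter>n\<in>{1..}. \<Union>i\<in>{n..}. preimage_T \<alpha> i (Ball2 (y, 0) (a i)))"
  have Lm: "L \<in> sets (borel \<Otimes>\<^sub>M count_space (UNIV :: bit set))" unfolding L_def
    by (rule sets.countable_INT') (auto intro!: sets.countable_UN' preimage_T_Ball2_measurable)
  define B where "B = (\<lambda>j. (\<lambda>x. (x, j)) -` L)"
  have B_borel: "B j \<in> sets borel" for j unfolding B_def by (rule sets_Pair2[OF Lm])
  have B_sub: "B j \<subseteq> {0..<1}" for j
    by (auto simp: B_def L_def preimage_T_def)
  have B_leb: "B j \<in> sets (lebesgue_on {0..<1})" for j
    using B_borel[of j] B_sub[of j] by (auto simp: sets_restrict_space_iff)
  \<comment> \<open>A finite fibre makes its counting measure sigma-finite, as the product formula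
    for rectangles requires.\<close>
  have "(UNIV :: bit set) = {0, 1}" by (auto intro: bit.exhaust)
  then have "finite (UNIV :: bit set)" by (metis finite.emptyI finite_insert)
  then interpret bit: sigma_finite_measure "count_space (UNIV :: bit set)"
    by (rule sigma_finite_measure_count_space_finite)
  have slice: "emeasure lambda2 (B j \<times> {j}) = emeasure lebesgue (B j)" for j
    unfolding lambda2_def using B_leb[of j] B_sub[of j]
    by (subst bit.emeasure_pair_measure_Times) (auto simp: emeasure_restrict_space)
  have slice_m: "B j \<times> {j} \<in> sets lambda2" for j
    unfolding lambda2_def using B_leb[of j] by (intro pair_measureI) auto
  have L_eq: "L = B 0 \<times> {0} \<union> B 1 \<times> {1}"
    unfolding B_def by (auto simp: set_eq_iff) (metis bit.exhaust)+

  have cover: "x \<in> B 0 \<union> B 1" if x: "x \<in> {0<..<1}" "x \<notin> Z" for x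
  proof -
    have x1: "x \<in> {0..<1}" using x by auto
    obtain s where s: "\<And>n j. (skew_T \<alpha> ^^ n) (x, j) = (frac (x + real n * \<alpha>), j + s n)"
      using skew_T_iterate[OF x1, where \<alpha> = \<alpha>] by metis
    \<comment> \<open>Starting in fibre \<open>s i\<close> leads to \<open>s i + s i = 0\<close>,
      the fibre of the target, at time \<open>i\<close>.\<close>
    have hit: "(x, s i) \<in> preimage_T \<alpha> i (Ball2 (y, 0) (a i))" if "\<bar>x - p i\<bar> < a i" for i
    proof -
      have "dist_int (frac (x + real i * \<alpha>) - y)
          \<le> \<bar>frac (x + real i * \<alpha>) - y - of_int (- \<lfloor>x + real i * \<alpha>\<rfloor> - \<lfloor>y - real i * \<alpha>\<rfloor>)\<bar>"
        by (rule dist_int_le)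
      also have "\<dots> = \<bar>x - p i\<bar>" unfolding p_def frac_def by (simp add: algebra_simps)
      finally show ?thesis
        using that x1 by (auto simp: preimage_T_def s Ball2_def frac_lt_1)
    qed
    have io: "\<exists>i\<ge>m. \<bar>x - p i\<bar> < a i" for m
      using x by (auto simp: Z_def not_le)
    show ?thesis
    proof (rule ccontr)
      \<comment> \<open>Each of the two starting points would stop hitting after some time; a close
        approach later than both contradicts this for either value of \<open>s i\<close>.\<close>
      assume "x \<notin> B 0 \<union> B 1"
      then obtain m n where "\<And>i. i \<ge> m \<Longrightarrow> (x, 0) \<notin> preimage_T \<alpha> i (Ball2 (y, 0) (a i))"
        "\<And>i. i \<ge> n \<Longrightarrow> (x, 1) \<notin> preimage_T \<alpha> i (Ball2 (y, 0) (a i))"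
        unfolding B_def L_def by auto
      moreover obtain i where "i \<ge> max m n" "\<bar>x - p i\<bar> < a i" using io by blast
      ultimately show False using hit[of i] by (cases "s i") auto
    qed
  qed
  \<comment> \<open>The sections cover the open unit interval up to \<open>Z\<close>, and their
    measures add up to that of \<open>L\<close> because the slices lie in different fibres.\<close>
  have "1 = emeasure lebesgue {0<..<1::real}" by simp
  also have "\<dots> \<le> emeasure lebesgue ((B 0 \<union> B 1) \<union> Z)"
    using Z B_borel by (intro emeasure_mono subsetI) (use cover in blast, auto intro!: sets.Un)
  also have "\<dots> = emeasure lebesgue (B 0 \<union> B 1)"
    using Z B_borel by (intro emeasure_Un_null_set) auto
  also have "\<dots> \<le> emeasure lebesgue (B 0) + emeasure lebesgue (B 1)"
    using B_borel by (intro emeasure_subadditive) auto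
  also have "\<dots> = emeasure lambda2 (B 0 \<times> {0} \<union> B 1 \<times> {1})"
    unfolding slice[symmetric] using slice_m by (intro plus_emeasure) auto
  finally show "emeasure lambda2 (\<Inter>n\<in>{1..}. \<Union>i\<in>{n..}. preimage_T \<alpha> i (Ball2 (y, 0) (a i))) \<ge> 1"
    unfolding L_def[symmetric] L_eq .
qed

end
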